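(* Let $Q,R,S\in\mathfrak{P}$ with $Q\cap R=\emptyset$ and $Q\cap S=\emptyset$. If $Q+R\sqsubseteq_I Q+S$, then $R\sqsubseteq_I S$.
   Context: $\mathfrak{P}$ is the class of finite nonempty posets and $\mathfrak{P}_r$ a fixed system of representatives of its isomorphism classes. $\mathcal{H}(P,Q)$ is the set of order-preserving maps $P\to Q$. $A+B$ denotes the direct sum (disjoint union without comparabilities between the summands). For $A\subseteq P$, $x\in A$: $\gamma_A(x)$ is the set of $y\in A$ joined to $x$ by a sequence $x=z_0,\dots,z_L=y$ in $A$ ($L\ge0$) with consecutive elements strictly comparable. For a map $\xi$ on $P$, $G_\xi(x):=\gamma_{\xi^{-1}(\xi(x))}(x)$. For $A\subseteq P$, ${\downarrow^{\circ}}A:=\{y\in P: y\le a\text{ for some }a\in A\}\setminus A$ and ${\uparrow_{\circ}}A:=\{y\in P: y\ge a\text{ for some }a\in A\}\setminus A$. The EV-system $\mathcal{E}(P)$ is the set of triples $(x,D,U)$ with $x\in P$, $D\subseteq{\downarrow^{\circ}}\{x\}$, $U\subseteq{\uparrow_{\circ}}\{x\}$; on it, $\mathfrak a<_+\mathfrak b$ iff $\mathfrak a_1\in\mathfrak b_2$ and $\mathfrak b_1\in\mathfrak a_3$, and $\le_+$ is $<_+$ together with equality. For $\xi\in\mathcal{H}(P,Q)$ and $x\in P$, $\alpha_{P,\xi}(x):=(\xi(x),\xi({\downarrow^{\circ}}G_\xi(x)),\xi({\uparrow_{\circ}}G_\xi(x)))\in\mathcal{E}(Q)$. For $R,S\in\mathfrak{P}$,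 a Hom-scheme from $R$ to $S$ is a family $\rho=(\rho_P)_{P\in\mathfrak{P}_r}$ of maps $\rho_P:\mathcal{H}(P,R)\to\mathcal{H}(P,S)$; it is strong if every $\rho_P$ is injective; it is an I-scheme if for all $P,P'\in\mathfrak{P}_r$, $\xi\in\mathcal{H}(P,R)$, $\zeta\in\mathcal{H}(P',R)$, $x\in P$, $y\in P'$: $\alpha_{P,\xi}(x)\le_+\alpha_{P',\zeta}(y)$ implies $\alpha_{P,\rho_P(\xi)}(x)\le_+\alpha_{P',\rho_{P'}(\zeta)}(y)$, where $<_+$ on the left implies $<_+$ on the right. $R\sqsubseteq_I S$ means that a strong I-scheme from $R$ to $S$ exists. *)

theory Defs
  imports Main "HOL-Library.FuncSet"
begin

text \<open>
  A poset is represented by its (reflexive) order relation \<open>P\<close>; its carrier is \<open>Field P\<close>,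
  and \<open>(x, y) \<in> P\<close> means \<open>x \<le> y\<close>.
\<close>

definition finite_poset :: "'a rel \<Rightarrow> bool" where
  "finite_poset P \<longleftrightarrow> Partial_order P \<and> finite (Field P) \<and> Field P \<noteq> {}"

definition isomorphic :: "'a rel \<Rightarrow> 'b rel \<Rightarrow> bool" where
  "isomorphic P Q \<longleftrightarrow> (\<exists>f. bij_betw f (Field P) (Field Q) \<and>
     (\<forall>x\<in>Field P. \<forall>y\<in>Field P. (x, y) \<in> P \<longleftrightarrow> (f x, f y) \<in> Q))"

text \<open>
  Every finite poset is isomorphic to one on natural numbers, so letting \<open>X\<close> range over
  relations on \<^typ>\<open>nat\<close> covers all isomorphism types.
\<close>

definition representative_system :: "'p rel set \<Rightarrow> bool" where
  "representative_system \<PP> \<longleftrightarrow> (\<forall>P\<in>\<PP>. finite_poset P) \<and>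
     (\<forall>X :: nat rel. finite_poset X \<longrightarrow> (\<exists>!P. P \<in> \<PP> \<and> isomorphic X P))"

text \<open>Extensionality makes equality of homomorphisms coincide with equality on the carrier.\<close>

definition Hom :: "'p rel \<Rightarrow> 'a rel \<Rightarrow> ('p \<Rightarrow> 'a) set" where
  "Hom P Q = {\<xi> \<in> Field P \<rightarrow>\<^sub>E Field Q. \<forall>x y. (x, y) \<in> P \<longrightarrow> (\<xi> x, \<xi> y) \<in> Q}"

text \<open>This is the direct sum only for posets with disjoint carriers.\<close>

definition direct_sum :: "'a rel \<Rightarrow> 'a rel \<Rightarrow> 'a rel" where
  "direct_sum P Q = P \<union> Q"

definition component :: "'p rel \<Rightarrow> 'p set \<Rightarrow> 'p \<Rightarrow> 'p set" where
  "component P A x = {y \<in> A.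
     (x, y) \<in> {(u, v). u \<in> A \<and> v \<in> A \<and> u \<noteq> v \<and> ((u, v) \<in> P \<or> (v, u) \<in> P)}\<^sup>*}"

definition fibre_component :: "'p rel \<Rightarrow> ('p \<Rightarrow> 'a) \<Rightarrow> 'p \<Rightarrow> 'p set" where
  "fibre_component P \<xi> x = component P {z \<in> Field P. \<xi> z = \<xi> x} x"

definition strict_down :: "'p rel \<Rightarrow> 'p set \<Rightarrow> 'p set" where
  "strict_down P A = {y \<in> Field P. \<exists>a\<in>A. (y, a) \<in> P} - A"

definition strict_up :: "'p rel \<Rightarrow> 'p set \<Rightarrow> 'p set" where
  "strict_up P A = {y \<in> Field P. \<exists>a\<in>A. (a, y) \<in> P} - A"

type_synonym 'a ev = "'a \<times> 'a set \<times> 'a set"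

definition EV_system :: "'a rel \<Rightarrow> 'a ev set" where
  "EV_system P = {(x, D, U). x \<in> Field P \<and> D \<subseteq> strict_down P {x} \<and> U \<subseteq> strict_up P {x}}"

definition ev_less :: "'a rel \<Rightarrow> 'a ev \<Rightarrow> 'a ev \<Rightarrow> bool" where
  "ev_less P \<aa> \<bb> \<longleftrightarrow> \<aa> \<in> EV_system P \<and> \<bb> \<in> EV_system P \<and>
     fst \<aa> \<in> fst (snd \<bb>) \<and> fst \<bb> \<in> snd (snd \<aa>)"

definition ev_le :: "'a rel \<Rightarrow> 'a ev \<Rightarrow> 'a ev \<Rightarrow> bool" where
  "ev_le P \<aa> \<bb> \<longleftrightarrow> ev_less P \<aa> \<bb> \<or> (\<aa> \<in> EV_system P \<and> \<aa> = \<bb>)"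

definition ev_of :: "'p rel \<Rightarrow> ('p \<Rightarrow> 'a) \<Rightarrow> 'p \<Rightarrow> 'a ev" where
  "ev_of P \<xi> x = (\<xi> x, \<xi> ` strict_down P (fibre_component P \<xi> x),
                      \<xi> ` strict_up P (fibre_component P \<xi> x))"

lemma ev_of_in_EV_system:
  assumes P: "Partial_order P" and \<xi>: "\<xi> \<in> Hom P Q" and x: "x \<in> Field P"
  shows "ev_of P \<xi> x \<in> EV_system Q"
proof -
  let ?A = "{z \<in> Field P. \<xi> z = \<xi> x}"
  let ?S = "{(u, v). u \<in> ?A \<and> v \<in> ?A \<and> u \<noteq> v \<and> ((u, v) \<in> P \<or> (v, u) \<in> P)}"
  have G: "fibre_component P \<xi> x = {y \<in> ?A. (x, y) \<in> ?S\<^sup>*}"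
    by (simp add: fibre_component_def component_def)
  have mono: "(\<xi> u, \<xi> v) \<in> Q" if "(u, v) \<in> P" for u v
    using \<xi> that by (auto simp: Hom_def)
  have closed: "y \<in> fibre_component P \<xi> x"
    if a: "a \<in> fibre_component P \<xi> x" and y: "y \<in> Field P" "\<xi> y = \<xi> x"
      and ya: "(y, a) \<in> P \<or> (a, y) \<in> P" for a y
  proof (cases "y = a")
    case False
    with a y ya have "(a, y) \<in> ?S" unfolding G by auto
    with a have "(x, y) \<in> ?S\<^sup>*" unfolding G by (auto intro: rtrancl_into_rtrancl)
    with y show ?thesis unfolding G by blast
  qed (use a in simp)
  have D: "\<xi> y \<in> strict_down Q {\<xi> x}" if "y \<in> strict_down P (fibre_component P \<xi> x)" for y
  proof -
    from that obtain a where a: "a \<in> fibre_component P \<xi> x" "(y, a) \<in> P" "y \<in> Field P"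
      "y \<notin> fibre_component P \<xi> x" by (auto simp: strict_down_def)
    moreover have "\<xi> a = \<xi> x" using a(1) unfolding G by simp
    ultimately show ?thesis using mono[OF a(2)] closed[OF a(1,3)]
      by (auto simp: strict_down_def Field_def)
  qed
  have U: "\<xi> y \<in> strict_up Q {\<xi> x}" if "y \<in> strict_up P (fibre_component P \<xi> x)" for y
  proof -
    from that obtain a where a: "a \<in> fibre_component P \<xi> x" "(a, y) \<in> P" "y \<in> Field P"
      "y \<notin> fibre_component P \<xi> x" by (auto simp: strict_up_def)
    moreover have "\<xi> a = \<xi> x" using a(1) unfolding G by simp
    ultimately show ?thesis using mono[OF a(2)] closed[OF a(1,3)]
      by (auto simp: strict_up_def Field_def)
  qed
  have "\<xi> x \<in> Field Q" using \<xi> x by (auto simp: Hom_def)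
  with D U show ?thesis by (auto simp: ev_of_def EV_system_def)
qed

text \<open>
  A family \<open>\<rho>\<close> is relevant only at indices in \<open>\<PP>\<close>, and there only on \<open>Hom P R\<close>.
\<close>

definition Hom_scheme ::
  "'p rel set \<Rightarrow> 'a rel \<Rightarrow> 'b rel \<Rightarrow> ('p rel \<Rightarrow> ('p \<Rightarrow> 'a) \<Rightarrow> ('p \<Rightarrow> 'b)) \<Rightarrow> bool" where
  "Hom_scheme \<PP> R S \<rho> \<longleftrightarrow> (\<forall>P\<in>\<PP>. \<rho> P \<in> Hom P R \<rightarrow> Hom P S)"

definition strong_scheme ::
  "'p rel set \<Rightarrow> 'a rel \<Rightarrow> ('p rel \<Rightarrow> ('p \<Rightarrow> 'a) \<Rightarrow> ('p \<Rightarrow> 'b)) \<Rightarrow> bool" where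
  "strong_scheme \<PP> R \<rho> \<longleftrightarrow> (\<forall>P\<in>\<PP>. inj_on (\<rho> P) (Hom P R))"

definition I_scheme ::
  "'p rel set \<Rightarrow> 'a rel \<Rightarrow> 'b rel \<Rightarrow> ('p rel \<Rightarrow> ('p \<Rightarrow> 'a) \<Rightarrow> ('p \<Rightarrow> 'b)) \<Rightarrow> bool" where
  "I_scheme \<PP> R S \<rho> \<longleftrightarrow>
     (\<forall>P\<in>\<PP>. \<forall>P'\<in>\<PP>. \<forall>\<xi>\<in>Hom P R. \<forall>\<zeta>\<in>Hom P' R. \<forall>x\<in>Field P. \<forall>y\<in>Field P'.
        (ev_le R (ev_of P \<xi> x) (ev_of P' \<zeta> y) \<longrightarrow>
           ev_le S (ev_of P (\<rho> P \<xi>) x) (ev_of P' (\<rho> P' \<zeta>) y)) \<and>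
        (ev_less R (ev_of P \<xi> x) (ev_of P' \<zeta> y) \<longrightarrow>
           ev_less S (ev_of P (\<rho> P \<xi>) x) (ev_of P' (\<rho> P' \<zeta>) y)))"

definition I_below :: "'p rel set \<Rightarrow> 'a rel \<Rightarrow> 'b rel \<Rightarrow> bool" where
  "I_below \<PP> R S \<longleftrightarrow>
     (\<exists>\<rho>. Hom_scheme \<PP> R S \<rho> \<and> strong_scheme \<PP> R \<rho> \<and> I_scheme \<PP> R S \<rho>)"

end

theory Submission
  imports Defs
begin

text \<open>
  The relation \<open>R \<sqsubseteq>\<^sub>I S\<close> holds iff \<open>card R \<le> card S\<close> and some vertex map \<open>g\<close> sends the strict
  pairs of \<open>R\<close> injectively to strict pairs of \<open>S\<close>. Given such a \<open>g\<close> and an injection \<open>f\<close>, let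
  \<open>\<rho>\<^sub>P(\<xi>)\<close> act as \<open>f \<circ> \<xi>\<close> on the connected components of \<open>P\<close> on which \<open>\<xi>\<close> is constant, and as
  \<open>g \<circ> \<xi>\<close> on the others. Conversely, \<open>f\<close> and \<open>g\<close> are read off from the homomorphisms of the
  zigzag \<open>p < q > q' < r\<close>. Given \<open>g\<close> for \<open>Q + R\<close> and \<open>Q + S\<close>, a map for \<open>R\<close> and \<open>S\<close> arises by
  iterating \<open>g\<close> until the orbit leaves \<open>Q\<close>: comparable points leave \<open>Q\<close> simultaneously, and an orbit
  of strict pairs that starts outside \<open>Q\<close> cannot stay in the finite \<open>Q\<close>, by injectivity.
\<close>

section \<open>Fibre components\<close>

text \<open>Adjacency inside the fibres, free of a base point: on the carrier, the fibre components
  become the classes of one equivalence relation.\<close>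

definition fibre_step :: "'p rel \<Rightarrow> ('p \<Rightarrow> 'a) \<Rightarrow> 'p rel" where
  "fibre_step P \<xi> = {(u, v). u \<noteq> v \<and> ((u, v) \<in> P \<or> (v, u) \<in> P) \<and> \<xi> u = \<xi> v}"

text \<open>A path of fibre steps keeps the value of \<open>\<xi>\<close>, so a path from
  \<open>x\<close> never leaves the fibre of \<open>x\<close>, and confining the steps to that fibre
  changes nothing.\<close>

lemma fibre_component_eq:
  assumes "x \<in> Field P"
  shows "fibre_component P \<xi> x = (fibre_step P \<xi>)\<^sup>* `` {x}"
proof -
  let ?A = "{z \<in> Field P. \<xi> z = \<xi> x}"
  let ?S = "{(u, v). u \<in> ?A \<and> v \<in> ?A \<and> u \<noteq> v \<and> ((u, v) \<in> P \<or> (v, u) \<in> P)}"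
  have "?S\<^sup>* \<subseteq> (fibre_step P \<xi>)\<^sup>*"
    by (rule rtrancl_mono) (auto simp: fibre_step_def)
  moreover have "y \<in> ?A \<and> (x, y) \<in> ?S\<^sup>*" if "(x, y) \<in> (fibre_step P \<xi>)\<^sup>*" for y
    using that
  proof induction
    case (step y z)
    then have "(y, z) \<in> ?S" by (auto simp: fibre_step_def Field_def)
    then have "(x, z) \<in> ?S\<^sup>*" using step.IH by (meson rtrancl.rtrancl_into_rtrancl)
    then show ?case using \<open>(y, z) \<in> ?S\<close> by blast
  qed (use assms in auto)
  ultimately show ?thesis
    unfolding fibre_component_def component_def by blast
qed

lemma fibre_component_refl: "x \<in> Field P \<Longrightarrow> x \<in> fibre_component P \<xi> x"
  by (simp add: fibre_component_eq)

lemma fibre_componentD: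
  "y \<in> fibre_component P \<xi> x \<Longrightarrow> y \<in> Field P \<and> \<xi> y = \<xi> x"
  by (simp add: fibre_component_def component_def)

lemma fibre_component_absorb:
  assumes "x \<in> Field P" "y \<in> fibre_component P \<xi> x"
  shows "fibre_component P \<xi> y = fibre_component P \<xi> x"
proof -
  have "sym (fibre_step P \<xi>)" by (auto simp: sym_def fibre_step_def)
  then have s: "sym ((fibre_step P \<xi>)\<^sup>*)" by (rule sym_rtrancl)
  have xy: "(x, y) \<in> (fibre_step P \<xi>)\<^sup>*"
    using assms by (simp add: fibre_component_eq)
  then have yx: "(y, x) \<in> (fibre_step P \<xi>)\<^sup>*" using s by (meson symD)
  have "y \<in> Field P" using fibre_componentD[OF assms(2)] by simp
  then show ?thesis
    using assms(1) xy yx by (auto simp: fibre_component_eq)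
qed

lemma ev_of_absorb:
  assumes "x \<in> Field P" "y \<in> fibre_component P \<xi> x"
  shows "ev_of P \<xi> y = ev_of P \<xi> x"
  using fibre_component_absorb[OF assms] fibre_componentD[OF assms(2)]
  by (simp add: ev_of_def)

lemma fibre_component_step:
  assumes "x \<in> Field P" "a \<in> fibre_component P \<xi> x" "\<xi> y = \<xi> x" "(y, a) \<in> P \<or> (a, y) \<in> P"
  shows "y \<in> fibre_component P \<xi> x"
proof (cases "y = a")
  case False
  then have "(a, y) \<in> fibre_step P \<xi>"
    using assms fibre_componentD[OF assms(2)] by (auto simp: fibre_step_def)
  then show ?thesis
    using assms(1,2) by (auto simp: fibre_component_eq intro: rtrancl_into_rtrancl)
qed (use assms in simp)

text \<open>A point comparable to a member of the component joins it exactly when it has the same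
  value. Lying outside thus becomes a change of value along one edge.\<close>

lemma strict_down_fibre_component:
  assumes "x \<in> Field P"
  shows "y \<in> strict_down P (fibre_component P \<xi> x) \<longleftrightarrow>
    (\<exists>a\<in>fibre_component P \<xi> x. (y, a) \<in> P \<and> \<xi> y \<noteq> \<xi> a)"
proof -
  have "y \<notin> fibre_component P \<xi> x \<longleftrightarrow> \<xi> y \<noteq> \<xi> a"
    if "a \<in> fibre_component P \<xi> x" "(y, a) \<in> P" for a
    using fibre_component_step[OF assms that(1)] fibre_componentD[OF that(1)]
      fibre_componentD[of y P \<xi> x] that(2) by metis
  then show ?thesis by (auto simp: strict_down_def intro: FieldI1)
qed

lemma strict_up_fibre_component:
  assumes "x \<in> Field P"
  shows "y \<in> strict_up P (fibre_component P \<xi> x) \<longleftrightarrow>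
    (\<exists>a\<in>fibre_component P \<xi> x. (a, y) \<in> P \<and> \<xi> a \<noteq> \<xi> y)"
proof -
  have "y \<notin> fibre_component P \<xi> x \<longleftrightarrow> \<xi> a \<noteq> \<xi> y"
    if "a \<in> fibre_component P \<xi> x" "(a, y) \<in> P" for a
    using fibre_component_step[OF assms that(1)] fibre_componentD[OF that(1)]
      fibre_componentD[of y P \<xi> x] that(2) by metis
  then show ?thesis by (auto simp: strict_up_def intro: FieldI2)
qed

lemma ev_of_eq_if_comparable:
  assumes "(x, y) \<in> P" "\<xi> x = \<xi> y"
  shows "ev_of P \<xi> x = ev_of P \<xi> y"
proof -
  have "x \<in> Field P" "y \<in> Field P" using assms by (auto simp: Field_def)
  then show ?thesis
    using ev_of_absorb[OF \<open>x \<in> Field P\<close>, of y \<xi>] assms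
      fibre_component_step[OF _ fibre_component_refl, of x P \<xi> y] by simp
qed

text \<open>The change of value puts each end of the edge outside the component of the other, so
  each value occurs in the other's triple. Strict edges thereby feed the I-condition.\<close>

lemma ev_less_ev_of:
  assumes "Partial_order P" "\<xi> \<in> Hom P R" "(x, y) \<in> P" "\<xi> x \<noteq> \<xi> y"
  shows "ev_less R (ev_of P \<xi> x) (ev_of P \<xi> y)"
proof -
  have F: "x \<in> Field P" "y \<in> Field P" using assms by (auto simp: Field_def)
  have "x \<in> strict_down P (fibre_component P \<xi> y)" "y \<in> strict_up P (fibre_component P \<xi> x)"
    unfolding strict_down_fibre_component[OF F(2)] strict_up_fibre_component[OF F(1)]
    using assms(3,4) fibre_component_refl[OF F(1)] fibre_component_refl[OF F(2)] by blast+
  then show ?thesis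
    using ev_of_in_EV_system[OF assms(1,2)] F by (auto simp: ev_less_def ev_of_def)
qed

text \<open>Components depend only on which edges are collapsed. Glued maps and I-schemes both keep
  this set of edges, hence the components.\<close>

lemma fibre_component_cong:
  assumes "\<And>u v. (u, v) \<in> P \<Longrightarrow> \<xi> u = \<xi> v \<longleftrightarrow> \<zeta> u = \<zeta> v" "x \<in> Field P"
  shows "fibre_component P \<xi> x = fibre_component P \<zeta> x"
proof -
  have "fibre_step P \<xi> = fibre_step P \<zeta>"
    using assms(1) by (fastforce simp: fibre_step_def)
  then show ?thesis using assms(2) by (simp add: fibre_component_eq)
qed

lemma fibre_component_singleton:
  assumes "x \<in> Field P" "\<And>y. y \<noteq> x \<Longrightarrow> (x, y) \<in> P \<or> (y, x) \<in> P \<Longrightarrow> \<xi> y \<noteq> \<xi> x"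
  shows "fibre_component P \<xi> x = {x}"
proof -
  have "(x, z) \<notin> fibre_step P \<xi>" for z
    using assms(2)[of z] by (auto simp: fibre_step_def)
  then have "y = x" if "(x, y) \<in> (fibre_step P \<xi>)\<^sup>*" for y
    using that by (metis converse_rtranclE)
  then show ?thesis using assms(1) by (auto simp: fibre_component_eq)
qed

lemma Hom_ext:
  assumes "\<xi> \<in> Hom P R" "\<zeta> \<in> Hom P R" "\<And>x. x \<in> Field P \<Longrightarrow> \<xi> x = \<zeta> x"
  shows "\<xi> = \<zeta>"
  using assms unfolding Hom_def by (blast intro: PiE_ext)

lemma ev_less_imp_strict:
  "ev_less S \<aa> \<bb> \<Longrightarrow> (fst \<aa>, fst \<bb>) \<in> S - Id"
  by (auto simp: ev_less_def EV_system_def strict_down_def)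

section \<open>Schemes from pair injections\<close>

text \<open>Injectivity is asked of pairs only; \<open>g\<close> itself may identify points.\<close>

definition pair_injection :: "'a rel \<Rightarrow> 'b rel \<Rightarrow> ('a \<Rightarrow> 'b) \<Rightarrow> bool" where
  "pair_injection R S g \<longleftrightarrow>
     map_prod g g \<in> (R - Id) \<rightarrow> (S - Id) \<and> inj_on (map_prod g g) (R - Id)"

text \<open>For \<open>x\<close> in the carrier, both sets are empty exactly when no edge leaves the
  fibre component, that is, when it is a whole connected component of \<open>P\<close>.\<close>

definition glue_scheme ::
  "('a \<Rightarrow> 'b) \<Rightarrow> ('a \<Rightarrow> 'b) \<Rightarrow> 'p rel \<Rightarrow> ('p \<Rightarrow> 'a) \<Rightarrow> 'p \<Rightarrow> 'b" where
  "glue_scheme f g P \<xi> = (\<lambda>x\<in>Field P.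
     if snd (ev_of P \<xi> x) = ({}, {}) then f (\<xi> x) else g (\<xi> x))"

context
  fixes R :: "'a rel" and S :: "'b rel" and f g :: "'a \<Rightarrow> 'b"
  assumes S: "Partial_order S"
    and f: "f \<in> Field R \<rightarrow> Field S" "inj_on f (Field R)"
    and g: "pair_injection R S g"
begin

lemma glue_scheme_g:
  assumes "x \<in> Field P" "snd (ev_of P \<xi> x) \<noteq> ({}, {})"
  shows "glue_scheme f g P \<xi> x = g (\<xi> x)"
  using assms by (simp add: glue_scheme_def)

text \<open>Each end sees the value of the other in its triple, so both ends take the branch of
  \<open>g\<close>.\<close>

lemma glue_scheme_strict:
  assumes "Partial_order P" "\<xi> \<in> Hom P R" "(x, y) \<in> P" "\<xi> x \<noteq> \<xi> y"
  shows "glue_scheme f g P \<xi> x = g (\<xi> x)" "glue_scheme f g P \<xi> y = g (\<xi> y)"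
    "(g (\<xi> x), g (\<xi> y)) \<in> S - Id"
proof -
  have F: "x \<in> Field P" "y \<in> Field P" using assms by (auto simp: Field_def)
  have "ev_less R (ev_of P \<xi> x) (ev_of P \<xi> y)" by (rule ev_less_ev_of) fact+
  then have "snd (ev_of P \<xi> x) \<noteq> ({}, {})" "snd (ev_of P \<xi> y) \<noteq> ({}, {})"
    by (auto simp: ev_less_def)
  then show "glue_scheme f g P \<xi> x = g (\<xi> x)" "glue_scheme f g P \<xi> y = g (\<xi> y)"
    using F by (auto intro: glue_scheme_g)
  have "(\<xi> x, \<xi> y) \<in> R - Id" using assms by (auto simp: Hom_def)
  then show "(g (\<xi> x), g (\<xi> y)) \<in> S - Id"
    using g unfolding pair_injection_def by (metis PiE map_prod_simp)
qed

lemma glue_scheme_eq_iff: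
  assumes "Partial_order P" "\<xi> \<in> Hom P R" "(x, y) \<in> P"
  shows "glue_scheme f g P \<xi> x = glue_scheme f g P \<xi> y \<longleftrightarrow> \<xi> x = \<xi> y"
proof
  assume e: "\<xi> x = \<xi> y"
  have "x \<in> Field P" "y \<in> Field P" using assms by (auto simp: Field_def)
  then show "glue_scheme f g P \<xi> x = glue_scheme f g P \<xi> y"
    using e ev_of_eq_if_comparable[OF assms(3) e] by (simp add: glue_scheme_def)
next
  assume "glue_scheme f g P \<xi> x = glue_scheme f g P \<xi> y"
  then show "\<xi> x = \<xi> y" using glue_scheme_strict[OF assms] by fastforce
qed

lemma glue_scheme_Hom:
  assumes "Partial_order P" "\<xi> \<in> Hom P R"
  shows "glue_scheme f g P \<xi> \<in> Hom P S"
proof -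
  have F: "glue_scheme f g P \<xi> x \<in> Field S" if x: "x \<in> Field P" for x
  proof (cases "snd (ev_of P \<xi> x) = ({}, {})")
    case True
    then show ?thesis using x f(1) assms(2) by (auto simp: glue_scheme_def Hom_def)
  next
    case False
    \<comment> \<open>Since \<open>g\<close> is controlled only on strict pairs,
      \<open>\<xi> x\<close> needs a strictly comparable partner in \<open>R\<close>; any member of
      the two sets provides one.\<close>
    then obtain d where "d \<in> fst (snd (ev_of P \<xi> x)) \<or> d \<in> snd (snd (ev_of P \<xi> x))"
      by (metis all_not_in_conv prod.collapse)
    then have "d \<in> strict_down R {\<xi> x} \<or> d \<in> strict_up R {\<xi> x}"
      using ev_of_in_EV_system[OF assms x] by (auto simp: EV_system_def ev_of_def)
    then have "(d, \<xi> x) \<in> R - Id \<or> (\<xi> x, d) \<in> R - Id"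
      by (auto simp: strict_down_def strict_up_def)
    then have "(g d, g (\<xi> x)) \<in> S - Id \<or> (g (\<xi> x), g d) \<in> S - Id"
      using g unfolding pair_injection_def by (metis PiE map_prod_simp)
    then show ?thesis using glue_scheme_g[OF x False] by (auto simp: Field_def)
  qed
  have "(glue_scheme f g P \<xi> x, glue_scheme f g P \<xi> y) \<in> S" if xy: "(x, y) \<in> P" for x y
  proof (cases "\<xi> x = \<xi> y")
    case True
    have "y \<in> Field P" using xy by (auto simp: Field_def)
    then show ?thesis
      using glue_scheme_eq_iff[OF assms xy] True F S by (auto simp: refl_on_def order_on_defs)
  next
    case False
    then show ?thesis using glue_scheme_strict[OF assms xy] by simp
  qed
  then show ?thesis using F by (auto simp: Hom_def glue_scheme_def)
qed

lemma fibre_component_glue_scheme: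
  assumes "Partial_order P" "\<xi> \<in> Hom P R" "x \<in> Field P"
  shows "fibre_component P (glue_scheme f g P \<xi>) x = fibre_component P \<xi> x"
  by (rule fibre_component_cong[OF glue_scheme_eq_iff[OF assms(1,2)] assms(3)])

text \<open>Points in the two neighbour sets lie on strict edges, where \<open>g\<close> acts. The
  new triple is therefore a function of the old triple alone, which yields the I-condition.\<close>

lemma ev_of_glue_scheme:
  assumes P: "Partial_order P" "\<xi> \<in> Hom P R" and x: "x \<in> Field P"
  shows "ev_of P (glue_scheme f g P \<xi>) x =
    (if snd (ev_of P \<xi> x) = ({}, {}) then f (\<xi> x) else g (\<xi> x),
     g ` fst (snd (ev_of P \<xi> x)), g ` snd (snd (ev_of P \<xi> x)))"
proof -
  let ?h = "glue_scheme f g P \<xi>"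
  have "?h y = g (\<xi> y)" if "y \<in> strict_down P (fibre_component P \<xi> x)" for y
    using that glue_scheme_strict(1)[OF P] by (auto simp: strict_down_fibre_component[OF x])
  then have D: "?h ` strict_down P (fibre_component P \<xi> x) = g ` fst (snd (ev_of P \<xi> x))"
    by (simp add: ev_of_def image_image)
  have "?h y = g (\<xi> y)" if "y \<in> strict_up P (fibre_component P \<xi> x)" for y
    using that glue_scheme_strict(2)[OF P] by (auto simp: strict_up_fibre_component[OF x])
  then have U: "?h ` strict_up P (fibre_component P \<xi> x) = g ` snd (snd (ev_of P \<xi> x))"
    by (simp add: ev_of_def image_image)
  have "?h x = (if snd (ev_of P \<xi> x) = ({}, {}) then f (\<xi> x) else g (\<xi> x))"
    using x by (simp add: glue_scheme_def)
  then show ?thesis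
    using D U by (simp only: ev_of_def[of P ?h x] fibre_component_glue_scheme[OF P x])
qed

text \<open>The image shows which edges are collapsed, hence the components. A component with a
  strict edge leaving it gets its value back from pair injectivity of \<open>g\<close>, any other
  from injectivity of \<open>f\<close>.\<close>

lemma inj_on_glue_scheme:
  assumes P: "Partial_order P"
  shows "inj_on (glue_scheme f g P) (Hom P R)"
proof (rule inj_onI)
  fix \<xi> \<zeta>
  assume H: "\<xi> \<in> Hom P R" "\<zeta> \<in> Hom P R"
    and eq: "glue_scheme f g P \<xi> = glue_scheme f g P \<zeta>"
  have pair: "\<xi> u = \<zeta> u \<and> \<xi> v = \<zeta> v" if uv: "(u, v) \<in> P" "\<xi> u \<noteq> \<xi> v" for u v
  proof -
    have uv': "\<zeta> u \<noteq> \<zeta> v"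
      using uv glue_scheme_eq_iff[OF P H(1) uv(1)] glue_scheme_eq_iff[OF P H(2) uv(1)] eq
      by simp
    have "map_prod g g (\<xi> u, \<xi> v) = map_prod g g (\<zeta> u, \<zeta> v)"
      using glue_scheme_strict(1,2)[OF P H(1) uv] glue_scheme_strict(1,2)[OF P H(2) uv(1) uv'] eq
      by simp
    moreover have "(\<xi> u, \<xi> v) \<in> R - Id" "(\<zeta> u, \<zeta> v) \<in> R - Id"
      using H uv uv' by (auto simp: Hom_def)
    ultimately show ?thesis using g unfolding pair_injection_def by (meson inj_onD prod.inject)
  qed
  have G: "fibre_component P \<xi> x = fibre_component P \<zeta> x" if "x \<in> Field P" for x
    using fibre_component_glue_scheme[OF P H(1) that] fibre_component_glue_scheme[OF P H(2) that] eq
    by simp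
  have "\<xi> x = \<zeta> x" if x: "x \<in> Field P" for x
  proof (cases "snd (ev_of P \<xi> x) = ({}, {})")
    case True
    then have "snd (ev_of P \<zeta> x) = ({}, {})" by (simp add: ev_of_def G[OF x])
    then have "f (\<xi> x) = f (\<zeta> x)"
      using True x fun_cong[OF eq, of x] by (simp add: glue_scheme_def)
    moreover have "\<xi> x \<in> Field R" "\<zeta> x \<in> Field R" using x H by (auto simp: Hom_def)
    ultimately show ?thesis using f(2) by (meson inj_onD)
  next
    case False
    then obtain y a where a: "a \<in> fibre_component P \<xi> x"
      "(y, a) \<in> P \<or> (a, y) \<in> P" "\<xi> y \<noteq> \<xi> a"
      by (fastforce simp: ev_of_def strict_down_fibre_component[OF x]
          strict_up_fibre_component[OF x])
    then have "\<xi> a = \<zeta> a" using pair[of y a] pair[of a y] by auto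
    then show ?thesis
      using a(1) G[OF x] fibre_componentD[of a P \<xi> x] fibre_componentD[of a P \<zeta> x] by simp
  qed
  then show "\<xi> = \<zeta>" by (rule Hom_ext[OF H])
qed

lemma I_below_if_pair_injection:
  assumes \<PP>: "\<And>P. P \<in> \<PP> \<Longrightarrow> Partial_order P"
  shows "I_below \<PP> R S"
proof -
  have less: "ev_less S (ev_of P (glue_scheme f g P \<xi>) x) (ev_of P' (glue_scheme f g P' \<zeta>) y)"
    if "P \<in> \<PP>" "P' \<in> \<PP>" "\<xi> \<in> Hom P R" "\<zeta> \<in> Hom P' R" "x \<in> Field P" "y \<in> Field P'"
      and l: "ev_less R (ev_of P \<xi> x) (ev_of P' \<zeta> y)" for P P' \<xi> \<zeta> x y
  proof -
    have "ev_of P (glue_scheme f g P \<xi>) x \<in> EV_system S"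
      "ev_of P' (glue_scheme f g P' \<zeta>) y \<in> EV_system S"
      using that \<PP> by (auto intro!: ev_of_in_EV_system glue_scheme_Hom)
    moreover have "snd (ev_of P \<xi> x) \<noteq> ({}, {})" "snd (ev_of P' \<zeta> y) \<noteq> ({}, {})"
      using l by (auto simp: ev_less_def)
    moreover have "\<xi> x \<in> fst (snd (ev_of P' \<zeta> y))" "\<zeta> y \<in> snd (snd (ev_of P \<xi> x))"
      using l by (auto simp: ev_less_def ev_of_def)
    ultimately show ?thesis
      using that(1-6) by (simp add: ev_less_def ev_of_glue_scheme[OF \<PP>])
  qed
  have eq: "ev_of P (glue_scheme f g P \<xi>) x = ev_of P' (glue_scheme f g P' \<zeta>) y"
    if "P \<in> \<PP>" "P' \<in> \<PP>" "\<xi> \<in> Hom P R" "\<zeta> \<in> Hom P' R" "x \<in> Field P" "y \<in> Field P'"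
      and e: "ev_of P \<xi> x = ev_of P' \<zeta> y" for P P' \<xi> \<zeta> x y
  proof -
    have "\<xi> x = \<zeta> y" using e by (simp add: ev_of_def)
    then show ?thesis using that(1-6) e by (simp add: ev_of_glue_scheme[OF \<PP>])
  qed
  have EV: "ev_of P (glue_scheme f g P \<xi>) x \<in> EV_system S"
    if "P \<in> \<PP>" "\<xi> \<in> Hom P R" "x \<in> Field P" for P \<xi> x
    using that by (intro ev_of_in_EV_system glue_scheme_Hom \<PP>)
  have "I_scheme \<PP> R S (glue_scheme f g)"
    unfolding I_scheme_def ev_le_def
    by (intro ballI conjI impI) (use less eq EV in blast)+
  moreover have "Hom_scheme \<PP> R S (glue_scheme f g)" "strong_scheme \<PP> R (glue_scheme f g)"
    unfolding Hom_scheme_def strong_scheme_def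
    by (auto intro!: glue_scheme_Hom inj_on_glue_scheme \<PP>)
  ultimately show ?thesis unfolding I_below_def by blast
qed

end

section \<open>Pair injections from schemes\<close>

lemma representative_of:
  assumes "representative_system \<PP>" "finite_poset (X :: nat rel)"
  obtains P where "P \<in> \<PP>" "isomorphic X P"
  using assms by (metis representative_system_def)

lemma isomorphicE:
  assumes "isomorphic X P"
  obtains f where "inj_on f (Field X)" "P = map_prod f f ` X"
proof -
  obtain f where f: "bij_betw f (Field X) (Field P)"
    and iff: "\<And>x y. x \<in> Field X \<Longrightarrow> y \<in> Field X \<Longrightarrow> (x, y) \<in> X \<longleftrightarrow> (f x, f y) \<in> P"
    using assms by (auto simp: isomorphic_def)
  have "P \<subseteq> map_prod f f ` X"
  proof
    fix e assume e: "e \<in> P"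
    obtain u v where uv: "e = (u, v)" by (cases e)
    then have "u \<in> f ` Field X" "v \<in> f ` Field X"
      using e f by (auto simp: bij_betw_def Field_def)
    then show "e \<in> map_prod f f ` X" using e uv iff by force
  qed
  moreover have "map_prod f f ` X \<subseteq> P"
    using iff by (auto simp: Field_def)
  ultimately show thesis
    using that f by (auto simp: bij_betw_def)
qed

text \<open>A fence with two inner points: collapsing \<open>q'\<close> and \<open>q\<close> yields
  a three-element chain, and a triple at an end point involves only one edge when that edge is
  strict.\<close>

definition zigzag :: "'p \<Rightarrow> 'p \<Rightarrow> 'p \<Rightarrow> 'p \<Rightarrow> 'p rel" where
  "zigzag p q q' r = {(p, p), (q, q), (q', q'), (r, r), (p, q), (q', q), (q', r)}"

lemma Field_zigzag: "Field (zigzag p q q' r) = {p, q, q', r}"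
  by (auto simp: zigzag_def Field_def)

text \<open>Only some isomorphic copy belongs to the system; its points are the images of 0, 1, 2,
  3.\<close>

lemma representative_zigzag:
  assumes "representative_system \<PP>"
  obtains p q q' r where "distinct [p, q, q', r]" "zigzag p q q' r \<in> \<PP>"
proof -
  let ?Z = "zigzag 0 1 2 (3::nat)"
  have "Refl ?Z" "antisym ?Z"
    unfolding refl_on_def antisym_def Field_zigzag by (auto simp: zigzag_def)
  moreover have "trans ?Z"
    by (rule transI) (auto simp: zigzag_def)
  ultimately have "finite_poset ?Z"
    by (simp add: finite_poset_def order_on_defs Field_zigzag) (simp add: zigzag_def)
  then obtain P where P: "P \<in> \<PP>" "isomorphic ?Z P"
    using representative_of[OF assms] by metis
  from P(2) obtain f where f: "inj_on f (Field ?Z)" "P = map_prod f f ` ?Z"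
    by (rule isomorphicE)
  have "P = zigzag (f 0) (f 1) (f 2) (f 3)" by (simp add: f(2) zigzag_def)
  moreover have "distinct [f 0, f 1, f 2, f 3]"
    using f(1) by (auto simp: Field_zigzag inj_on_def)
  ultimately show thesis using that P(1) by metis
qed

section \<open>What a strong I-scheme preserves\<close>

context
  fixes \<PP> :: "'p rel set" and R :: "'a rel" and S :: "'b rel"
    and \<rho> :: "'p rel \<Rightarrow> ('p \<Rightarrow> 'a) \<Rightarrow> ('p \<Rightarrow> 'b)"
  assumes \<PP>: "\<And>P. P \<in> \<PP> \<Longrightarrow> Partial_order P"
    and R: "Partial_order R" and S: "Partial_order S"
    and \<rho>: "Hom_scheme \<PP> R S \<rho>" "strong_scheme \<PP> R \<rho>" "I_scheme \<PP> R S \<rho>"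
begin

text \<open>Equal triples are related by \<open>ev_le\<close> in both directions, and so are their
  images. Different images would satisfy \<open>ev_less\<close> both ways, against antisymmetry of
  \<open>S\<close>.\<close>

lemma scheme_ev_eq:
  assumes "P \<in> \<PP>" "P' \<in> \<PP>" "\<xi> \<in> Hom P R" "\<zeta> \<in> Hom P' R" "x \<in> Field P" "y \<in> Field P'"
    and e: "ev_of P \<xi> x = ev_of P' \<zeta> y"
  shows "ev_of P (\<rho> P \<xi>) x = ev_of P' (\<rho> P' \<zeta>) y"
proof (rule ccontr)
  assume ne: "ev_of P (\<rho> P \<xi>) x \<noteq> ev_of P' (\<rho> P' \<zeta>) y"
  have "ev_of P \<xi> x \<in> EV_system R" "ev_of P' \<zeta> y \<in> EV_system R"
    using assms \<PP> by (auto intro!: ev_of_in_EV_system)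
  then have "ev_le R (ev_of P \<xi> x) (ev_of P' \<zeta> y)" "ev_le R (ev_of P' \<zeta> y) (ev_of P \<xi> x)"
    using e by (auto simp: ev_le_def)
  then have "ev_le S (ev_of P (\<rho> P \<xi>) x) (ev_of P' (\<rho> P' \<zeta>) y)"
    "ev_le S (ev_of P' (\<rho> P' \<zeta>) y) (ev_of P (\<rho> P \<xi>) x)"
    using \<rho>(3) assms(1-6) by (auto simp: I_scheme_def)
  then have "ev_less S (ev_of P (\<rho> P \<xi>) x) (ev_of P' (\<rho> P' \<zeta>) y)"
    "ev_less S (ev_of P' (\<rho> P' \<zeta>) y) (ev_of P (\<rho> P \<xi>) x)"
    using ne by (auto simp: ev_le_def)
  then show False
    using S by (auto dest!: ev_less_imp_strict simp: order_on_defs antisym_def)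
qed

text \<open>A collapsed edge has equal triples at its ends, a strict one has triples related by
  \<open>ev_less\<close>; the scheme preserves both situations.\<close>

lemma scheme_eq_iff:
  assumes P: "P \<in> \<PP>" and \<xi>: "\<xi> \<in> Hom P R" and xy: "(x, y) \<in> P"
  shows "\<rho> P \<xi> x = \<rho> P \<xi> y \<longleftrightarrow> \<xi> x = \<xi> y"
proof
  have F: "x \<in> Field P" "y \<in> Field P" using xy by (auto simp: Field_def)
  {
    assume "\<xi> x = \<xi> y"
    then have "ev_of P (\<rho> P \<xi>) x = ev_of P (\<rho> P \<xi>) y"
      by (intro scheme_ev_eq P \<xi> F ev_of_eq_if_comparable xy)
    then show "\<rho> P \<xi> x = \<rho> P \<xi> y" by (simp add: ev_of_def)
  next
    assume e: "\<rho> P \<xi> x = \<rho> P \<xi> y"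
    show "\<xi> x = \<xi> y"
    proof (rule ccontr)
      assume "\<xi> x \<noteq> \<xi> y"
      then have "ev_less R (ev_of P \<xi> x) (ev_of P \<xi> y)"
        by (intro ev_less_ev_of[OF \<PP>[OF P] \<xi> xy])
      then have "ev_less S (ev_of P (\<rho> P \<xi>) x) (ev_of P (\<rho> P \<xi>) y)"
        using \<rho>(3) P \<xi> F by (auto simp: I_scheme_def)
      then show False using e by (auto dest!: ev_less_imp_strict simp: ev_of_def)
    qed
  }
qed

lemma ev_of_scheme:
  assumes "P \<in> \<PP>" "\<xi> \<in> Hom P R" "x \<in> Field P"
  shows "ev_of P (\<rho> P \<xi>) x = (\<rho> P \<xi> x, \<rho> P \<xi> ` strict_down P (fibre_component P \<xi> x),
    \<rho> P \<xi> ` strict_up P (fibre_component P \<xi> x))"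
  using fibre_component_cong[of P "\<rho> P \<xi>" \<xi> x] scheme_eq_iff[OF assms(1,2)] assms(3)
  by (simp add: ev_of_def)

section \<open>Evaluating the scheme on the zigzag\<close>

context
  fixes p q q' r :: 'p
  assumes pqr: "distinct [p, q, q', r]" and Z: "zigzag p q q' r \<in> \<PP>"
begin

abbreviation "Z \<equiv> zigzag p q q' r"

definition zmap :: "'a \<Rightarrow> 'a \<Rightarrow> 'a \<Rightarrow> 'a \<Rightarrow> 'p \<Rightarrow> 'a" where
  "zmap a b c d = (\<lambda>x\<in>Field Z. if x = p then a else if x = q then b else if x = q' then c else d)"

lemma zmap_simps [simp]:
  "zmap a b c d p = a" "zmap a b c d q = b" "zmap a b c d q' = c" "zmap a b c d r = d"
  using pqr by (auto simp: zmap_def Field_zigzag)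

lemma zmap_Hom:
  assumes "(a, b) \<in> R" "(c, b) \<in> R" "(c, d) \<in> R"
  shows "zmap a b c d \<in> Hom Z R"
proof -
  have "a \<in> Field R" "b \<in> Field R" "c \<in> Field R" "d \<in> Field R"
    using assms by (auto simp: Field_def)
  moreover from this have "(a, a) \<in> R" "(b, b) \<in> R" "(c, c) \<in> R" "(d, d) \<in> R"
    using R by (auto simp: order_on_defs refl_on_def)
  moreover have "zmap a b c d \<in> extensional (Field Z)" by (simp add: zmap_def)
  ultimately show ?thesis
    using assms by (auto simp: Hom_def PiE_def Field_zigzag) (auto simp: zigzag_def)
qed

lemma zigzag_ends:
  assumes \<xi>: "\<xi> \<in> Hom Z R"
  shows "\<xi> p \<noteq> \<xi> q \<Longrightarrow> fibre_component Z \<xi> p = {p}"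
    "\<xi> q' \<noteq> \<xi> r \<Longrightarrow> fibre_component Z \<xi> r = {r}"
    "\<xi> p \<noteq> \<xi> q \<Longrightarrow> \<xi> q' \<noteq> \<xi> q \<Longrightarrow> fibre_component Z \<xi> q = {q}"
    "\<xi> q' \<noteq> \<xi> q \<Longrightarrow> \<xi> q' \<noteq> \<xi> r \<Longrightarrow> fibre_component Z \<xi> q' = {q'}"
  using pqr by (auto intro!: fibre_component_singleton simp: Field_zigzag)
    (auto simp: zigzag_def)

lemma strict_zigzag:
  "strict_down Z {p} = {}" "strict_up Z {p} = {q}"
  "strict_down Z {q} = {p, q'}" "strict_up Z {q} = {}"
  "strict_down Z {q'} = {}" "strict_up Z {q'} = {q, r}"
  "strict_down Z {r} = {q'}" "strict_up Z {r} = {}"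
  using pqr by (auto simp: strict_down_def strict_up_def Field_zigzag) (auto simp: zigzag_def)

text \<open>The candidate images of the ends of a strict pair are read off at the inner points of
  the alternating map.\<close>

definition lower_image :: "'a \<Rightarrow> 'a \<Rightarrow> 'b" where
  "lower_image a b = \<rho> Z (zmap a b a b) q'"

definition upper_image :: "'a \<Rightarrow> 'a \<Rightarrow> 'b" where
  "upper_image a b = \<rho> Z (zmap a b a b) q"

text \<open>In the alternating map \<open>p\<close> and \<open>q'\<close> share the triple
  \<open>(a, {}, {b})\<close>, while \<open>r\<close> and \<open>q\<close> share
  \<open>(b, {a}, {})\<close>.\<close>

lemma scheme_zmap_pair:
  assumes ab: "(a, b) \<in> R" "a \<noteq> b"
  shows "\<rho> Z (zmap a b a b) p = lower_image a b" "\<rho> Z (zmap a b a b) r = upper_image a b"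
proof -
  have H: "zmap a b a b \<in> Hom Z R" using ab by (intro zmap_Hom)
  have "ev_of Z (zmap a b a b) p = ev_of Z (zmap a b a b) q'"
    "ev_of Z (zmap a b a b) r = ev_of Z (zmap a b a b) q"
    using ab by (simp_all add: ev_of_def zigzag_ends[OF H] strict_zigzag)
  from this[THEN scheme_ev_eq[OF Z Z H H, rotated 2]]
  show "\<rho> Z (zmap a b a b) p = lower_image a b" "\<rho> Z (zmap a b a b) r = upper_image a b"
    by (simp_all add: Field_zigzag lower_image_def upper_image_def ev_of_def)
qed

text \<open>The triple at \<open>r\<close> is \<open>(\<xi> r, {\<xi> q'}, {})\<close>, as in the
  alternating map. Equality of the image triples fixes the value at \<open>r\<close> by the first
  coordinate and the value at \<open>q'\<close> by the singleton.\<close>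

lemma scheme_right_pair:
  assumes \<xi>: "\<xi> \<in> Hom Z R" and ne: "\<xi> q' \<noteq> \<xi> r"
  shows "\<rho> Z \<xi> q' = lower_image (\<xi> q') (\<xi> r)" "\<rho> Z \<xi> r = upper_image (\<xi> q') (\<xi> r)"
proof -
  let ?a = "\<xi> q'" and ?b = "\<xi> r"
  have ab: "(?a, ?b) \<in> R" using \<xi> by (auto simp: Hom_def zigzag_def)
  then have H: "zmap ?a ?b ?a ?b \<in> Hom Z R" by (intro zmap_Hom)
  have "ev_of Z \<xi> r = ev_of Z (zmap ?a ?b ?a ?b) r"
    using ne by (simp add: ev_of_def zigzag_ends[OF H] zigzag_ends[OF \<xi>] strict_zigzag)
  then have "ev_of Z (\<rho> Z \<xi>) r = ev_of Z (\<rho> Z (zmap ?a ?b ?a ?b)) r"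
    by (intro scheme_ev_eq Z \<xi> H) (simp_all add: Field_zigzag)
  then show "\<rho> Z \<xi> q' = lower_image ?a ?b" "\<rho> Z \<xi> r = upper_image ?a ?b"
    using ne scheme_zmap_pair[OF ab ne]
    by (simp_all add: ev_of_scheme[OF Z] Field_zigzag zigzag_ends[OF H] zigzag_ends[OF \<xi>] \<xi> H
        strict_zigzag lower_image_def)
qed

lemma scheme_left_pair:
  assumes \<xi>: "\<xi> \<in> Hom Z R" and ne: "\<xi> p \<noteq> \<xi> q"
  shows "\<rho> Z \<xi> p = lower_image (\<xi> p) (\<xi> q)" "\<rho> Z \<xi> q = upper_image (\<xi> p) (\<xi> q)"
proof -
  let ?a = "\<xi> p" and ?b = "\<xi> q"
  have ab: "(?a, ?b) \<in> R" using \<xi> by (auto simp: Hom_def zigzag_def)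
  then have H: "zmap ?a ?b ?a ?b \<in> Hom Z R" by (intro zmap_Hom)
  have "ev_of Z \<xi> p = ev_of Z (zmap ?a ?b ?a ?b) p"
    using ne by (simp add: ev_of_def zigzag_ends[OF H] zigzag_ends[OF \<xi>] strict_zigzag)
  then have "ev_of Z (\<rho> Z \<xi>) p = ev_of Z (\<rho> Z (zmap ?a ?b ?a ?b)) p"
    by (intro scheme_ev_eq Z \<xi> H) (simp_all add: Field_zigzag)
  then show "\<rho> Z \<xi> p = lower_image ?a ?b" "\<rho> Z \<xi> q = upper_image ?a ?b"
    using ne scheme_zmap_pair[OF ab ne]
    by (simp_all add: ev_of_scheme[OF Z] Field_zigzag zigzag_ends[OF H] zigzag_ends[OF \<xi>] \<xi> H
        strict_zigzag upper_image_def)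
qed

text \<open>The chain is spread over the fence with \<open>b\<close> at both inner points; the
  scheme must collapse that inner edge too.\<close>

lemma upper_image_eq_lower_image:
  assumes "(a, b) \<in> R - Id" "(b, c) \<in> R - Id"
  shows "upper_image a b = lower_image b c"
proof -
  have "(b, b) \<in> R" using R assms by (auto simp: order_on_defs refl_on_def Field_def)
  then have H: "zmap a b b c \<in> Hom Z R" using assms by (intro zmap_Hom) auto
  have "\<rho> Z (zmap a b b c) q' = \<rho> Z (zmap a b b c) q"
    using scheme_eq_iff[OF Z H, of q' q] by (simp add: zigzag_def)
  then show ?thesis
    using scheme_left_pair[OF H] scheme_right_pair[OF H] assms by simp
qed

text \<open>With values \<open>a b a c\<close> the point \<open>q\<close> has the same triple as
  with \<open>a b a b\<close>. The image of its lower set is then \<open>{lower_image a b}\<close>,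
  which contains the value at \<open>q'\<close>, namely \<open>lower_image a c\<close>.\<close>

lemma lower_image_indep:
  assumes "(a, b) \<in> R - Id" "(a, c) \<in> R - Id"
  shows "lower_image a b = lower_image a c"
proof -
  have H: "zmap a b a c \<in> Hom Z R" "zmap a b a b \<in> Hom Z R"
    using assms by (auto intro!: zmap_Hom)
  have "ev_of Z (zmap a b a c) q = ev_of Z (zmap a b a b) q"
    using assms by (simp add: ev_of_def zigzag_ends[OF H(1)] zigzag_ends[OF H(2)] strict_zigzag)
  then have "ev_of Z (\<rho> Z (zmap a b a c)) q = ev_of Z (\<rho> Z (zmap a b a b)) q"
    by (intro scheme_ev_eq Z H) (simp_all add: Field_zigzag)
  then have "\<rho> Z (zmap a b a c) q' \<in> {\<rho> Z (zmap a b a b) p, \<rho> Z (zmap a b a b) q'}"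
    using assms
    by (simp add: ev_of_scheme[OF Z] Field_zigzag zigzag_ends[OF H(1)] zigzag_ends[OF H(2)] H
        strict_zigzag) blast
  then show ?thesis
    using scheme_right_pair[OF H(1)] scheme_zmap_pair[of a b] assms
    by (auto simp: lower_image_def)
qed

text \<open>Dual argument, comparing the upper sets at \<open>q'\<close>.\<close>

lemma upper_image_indep:
  assumes "(b, a) \<in> R - Id" "(c, a) \<in> R - Id"
  shows "upper_image b a = upper_image c a"
proof -
  have H: "zmap c a b a \<in> Hom Z R" "zmap b a b a \<in> Hom Z R"
    using assms by (auto intro!: zmap_Hom)
  have "ev_of Z (zmap c a b a) q' = ev_of Z (zmap b a b a) q'"
    using assms by (simp add: ev_of_def zigzag_ends[OF H(1)] zigzag_ends[OF H(2)] strict_zigzag)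
  then have "ev_of Z (\<rho> Z (zmap c a b a)) q' = ev_of Z (\<rho> Z (zmap b a b a)) q'"
    by (intro scheme_ev_eq Z H) (simp_all add: Field_zigzag)
  then have "\<rho> Z (zmap c a b a) q \<in> {\<rho> Z (zmap b a b a) q, \<rho> Z (zmap b a b a) r}"
    using assms
    by (simp add: ev_of_scheme[OF Z] Field_zigzag zigzag_ends[OF H(1)] zigzag_ends[OF H(2)] H
        strict_zigzag) blast
  then show ?thesis
    using scheme_left_pair[OF H(1)] scheme_zmap_pair[of b a] assms
    by (auto simp: upper_image_def)
qed

lemma ex_pair_injection: "\<exists>g. pair_injection R S g"
proof -
  \<comment> \<open>All candidate images of \<open>a\<close>, as a lower or as an upper end. The
    three preceding lemmas leave at most one; for an isolated \<open>a\<close> there is none and the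
    choice is arbitrary.\<close>
  define W where "W a = {lower_image a b |b. (a, b) \<in> R - Id} \<union> {upper_image b a |b. (b, a) \<in> R - Id}" for a
  define g where "g a = (SOME w. w \<in> W a)" for a
  have "v = w" if "v \<in> W a" "w \<in> W a" for v w a
    using that unfolding W_def
    by (elim UnE CollectE exE conjE)
      (metis lower_image_indep upper_image_indep upper_image_eq_lower_image)+
  then have g: "v = g a" if "v \<in> W a" for v a
    using that someI[of "\<lambda>w. w \<in> W a"] unfolding g_def by blast
  have lower: "lower_image a b = g a" if "(a, b) \<in> R - Id" for a b
    by (rule g) (use that in \<open>unfold W_def, blast\<close>)
  have upper: "upper_image a b = g b" if "(a, b) \<in> R - Id" for a b
    by (rule g) (use that in \<open>unfold W_def, blast\<close>)
  have vals: "\<rho> Z (zmap a b a b) p = g a" "\<rho> Z (zmap a b a b) q = g b"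
    "\<rho> Z (zmap a b a b) q' = g a" "\<rho> Z (zmap a b a b) r = g b" if "(a, b) \<in> R - Id" for a b
  proof -
    show "\<rho> Z (zmap a b a b) q = g b" "\<rho> Z (zmap a b a b) q' = g a"
      using lower[OF that] upper[OF that] by (simp_all add: lower_image_def upper_image_def)
    show "\<rho> Z (zmap a b a b) p = g a" "\<rho> Z (zmap a b a b) r = g b"
      using scheme_zmap_pair[of a b] that lower[OF that] upper[OF that] by simp_all
  qed
  have \<rho>Z: "\<rho> Z \<in> Hom Z R \<rightarrow> Hom Z S" "inj_on (\<rho> Z) (Hom Z R)"
    using \<rho>(1,2) Z by (auto simp: Hom_scheme_def strong_scheme_def)
  have strict: "(g a, g b) \<in> S - Id" if ab: "(a, b) \<in> R - Id" for a b
  proof -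
    have H: "zmap a b a b \<in> Hom Z R" using ab by (intro zmap_Hom) auto
    have "(p, q) \<in> Z" by (simp add: zigzag_def)
    moreover from this have "(\<rho> Z (zmap a b a b) p, \<rho> Z (zmap a b a b) q) \<in> S"
      using \<rho>Z(1) H by (auto simp: Hom_def Pi_iff)
    ultimately show ?thesis
      using scheme_eq_iff[OF Z H, of p q] ab vals[OF ab] by auto
  qed
  have inj: "a = a' \<and> b = b'"
    if ab: "(a, b) \<in> R - Id" and ab': "(a', b') \<in> R - Id" and e: "g a = g a'" "g b = g b'"
    for a b a' b'
  \<comment> \<open>Equal end values make the two image homomorphisms agree at all four points, so
    injectivity of \<open>\<rho> Z\<close> applies.\<close>
  proof -
    have H: "zmap a b a b \<in> Hom Z R" "zmap a' b' a' b' \<in> Hom Z R"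
      using ab ab' by (auto intro!: zmap_Hom)
    then have "\<rho> Z (zmap a b a b) \<in> Hom Z S" "\<rho> Z (zmap a' b' a' b') \<in> Hom Z S"
      using \<rho>Z(1) by auto
    then have "\<rho> Z (zmap a b a b) = \<rho> Z (zmap a' b' a' b')"
      by (rule Hom_ext) (use vals[OF ab] vals[OF ab'] e in \<open>auto simp: Field_zigzag\<close>)
    then have "zmap a b a b = zmap a' b' a' b'" using H \<rho>Z(2) by (meson inj_onD)
    then show ?thesis using zmap_simps by metis
  qed
  have "map_prod g g \<in> (R - Id) \<rightarrow> (S - Id)"
    using strict by (intro funcsetI) (auto simp: map_prod_def split_beta)
  moreover have "inj_on (map_prod g g) (R - Id)"
    by (rule inj_onI) (use inj in \<open>metis map_prod_simp prod.collapse prod.inject\<close>)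
  ultimately show ?thesis unfolding pair_injection_def by blast
qed

text \<open>The zigzag is connected, so the scheme sends constant maps to constant maps, and it does
  so injectively.\<close>

lemma ex_inj_on_Field: "\<exists>f. f \<in> Field R \<rightarrow> Field S \<and> inj_on f (Field R)"
proof (intro exI conjI)
  let ?f = "\<lambda>a. \<rho> Z (zmap a a a a) p"
  have \<rho>Z: "\<rho> Z \<in> Hom Z R \<rightarrow> Hom Z S" "inj_on (\<rho> Z) (Hom Z R)"
    using \<rho>(1,2) Z by (auto simp: Hom_scheme_def strong_scheme_def)
  have H: "zmap a a a a \<in> Hom Z R" if "a \<in> Field R" for a
    using that R by (auto intro!: zmap_Hom simp: order_on_defs refl_on_def)
  then have HS: "\<rho> Z (zmap a a a a) \<in> Hom Z S" if "a \<in> Field R" for a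
    using \<rho>Z(1) that by auto
  show "?f \<in> Field R \<rightarrow> Field S"
    using HS by (auto simp: Hom_def Field_zigzag PiE_iff)
  have const: "\<rho> Z (zmap a a a a) x = ?f a" if "a \<in> Field R" "x \<in> Field Z" for a x
    using that scheme_eq_iff[OF Z H[OF that(1)], of p q] scheme_eq_iff[OF Z H[OF that(1)], of q' q]
      scheme_eq_iff[OF Z H[OF that(1)], of q' r]
    by (auto simp: Field_zigzag) (auto simp: zigzag_def)
  show "inj_on ?f (Field R)"
  proof (rule inj_onI)
    fix a b assume ab: "a \<in> Field R" "b \<in> Field R" "?f a = ?f b"
    have "\<rho> Z (zmap a a a a) = \<rho> Z (zmap b b b b)"
      by (rule Hom_ext[OF HS HS]) (use ab const in auto)
    then have "zmap a a a a = zmap b b b b"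
      using H ab \<rho>Z(2) by (meson inj_onD)
    then show "a = b" using zmap_simps by metis
  qed
qed

end

end

lemma I_belowD:
  fixes R :: "'a rel" and S :: "'b rel"
  assumes rep: "representative_system \<PP>" and R: "Partial_order R" and S: "Partial_order S"
    and "I_below \<PP> R S"
  shows "\<exists>f. f \<in> Field R \<rightarrow> Field S \<and> inj_on f (Field R)" "\<exists>g. pair_injection R S g"
proof -
  have \<PP>: "Partial_order P" if "P \<in> \<PP>" for P
    using rep that by (auto simp: representative_system_def finite_poset_def)
  obtain \<rho> where \<rho>: "Hom_scheme \<PP> R S \<rho>" "strong_scheme \<PP> R \<rho>" "I_scheme \<PP> R S \<rho>"
    using assms(4) by (auto simp: I_below_def)
  obtain p q q' r where z: "distinct [p, q, q', r]" "zigzag p q q' r \<in> \<PP>"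
    using rep by (rule representative_zigzag)
  show "\<exists>f. f \<in> Field R \<rightarrow> Field S \<and> inj_on f (Field R)"
    by (rule ex_inj_on_Field[OF \<PP> R S \<rho> z])
  show "\<exists>g. pair_injection R S g"
    by (rule ex_pair_injection[OF \<PP> R S \<rho> z])
qed

section \<open>Cancellation\<close>

text \<open>Applications of \<open>F\<close> are peeled off one at a time, as long as both points
  lie where \<open>F\<close> is injective.\<close>

lemma funpow_cancel:
  assumes inj: "inj_on F (A \<union> B)" and b: "b \<in> B" "b' \<in> B"
    and A: "\<And>i. 0 < i \<Longrightarrow> i < m \<Longrightarrow> (F ^^ i) b \<in> A"
    and A': "\<And>i. 0 < i \<Longrightarrow> i < m + n \<Longrightarrow> (F ^^ i) b' \<in> A"
    and eq: "(F ^^ m) b = (F ^^ (m + n)) b'"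
  shows "b = (F ^^ n) b'"
  using A A' eq
proof (induction m)
  case (Suc m)
  \<comment> \<open>At exponent 0 the point is the start itself, which lies in \<open>B\<close>
    rather than \<open>A\<close>.\<close>
  have "(F ^^ m) b \<in> A \<union> B" "(F ^^ (m + n)) b' \<in> A \<union> B"
    using Suc.prems(1)[of m] Suc.prems(2)[of "m + n"] b by (cases "m = 0"; cases "m + n = 0"; auto)+
  then have "(F ^^ m) b = (F ^^ (m + n)) b'"
    using Suc.prems(3) inj by (auto dest: inj_onD)
  then show ?case using Suc.IH Suc.prems(1,2) by simp
qed simp

text \<open>An orbit confined to the finite \<open>A\<close> would repeat; cancelling makes
  \<open>b\<close> a later iterate of itself, hence a member of both \<open>A\<close> and
  \<open>B\<close>.\<close>

lemma funpow_leaves: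
  assumes inj: "inj_on F (A \<union> B)" and "finite A" "A \<inter> B = {}" "b \<in> B"
  shows "\<exists>k>0. (F ^^ k) b \<notin> A"
proof (rule ccontr)
  assume "\<not> ?thesis"
  then have A: "(F ^^ k) b \<in> A" if "0 < k" for k using that by blast
  have "\<not> inj_on (\<lambda>k. (F ^^ k) b) {0<..}"
    using A \<open>finite A\<close> by (metis (no_types, lifting) finite_imageD finite_subset greaterThan_iff
        image_subsetI infinite_Ioi)
  then obtain i j where "0 < i" "i < j" "(F ^^ i) b = (F ^^ j) b"
    by (auto simp: inj_on_def) (metis linorder_neqE_nat)
  then have "b = (F ^^ (j - i)) b"
    using funpow_cancel[OF inj \<open>b \<in> B\<close> \<open>b \<in> B\<close>, of i "j - i"] A by simp
  then show False using A[of "j - i"] \<open>i < j\<close> assms by auto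
qed

section \<open>Direct sums and cancelling a summand\<close>

lemma Field_direct_sum: "Field (direct_sum P Q) = Field P \<union> Field Q"
  by (auto simp: direct_sum_def Field_def)

lemma Partial_order_direct_sum:
  assumes "Partial_order P" "Partial_order Q" "Field P \<inter> Field Q = {}"
  shows "Partial_order (direct_sum P Q)"
proof -
  have no: False if "(x, y) \<in> P" "(u, v) \<in> Q" "x = u \<or> x = v \<or> y = u \<or> y = v" for x y u v
    using that assms(3) by (auto simp: Field_def)
  have "antisym (P \<union> Q)"
    using assms(1,2) no by (intro antisymI) (unfold order_on_defs antisym_def, blast)
  moreover have "trans (P \<union> Q)"
    using assms(1,2) no by (intro transI) (unfold order_on_defs trans_def, blast)
  moreover have "refl_on (Field P \<union> Field Q) (P \<union> Q)"
    using assms(1,2) by (simp add: order_on_defs refl_on_Un)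
  moreover have "P \<union> Q \<subseteq> (Field P \<union> Field Q) \<times> (Field P \<union> Field Q)"
    by (auto simp: Field_def)
  ultimately show ?thesis
    by (simp only: order_on_defs Field_direct_sum) (simp add: direct_sum_def)
qed

lemma pair_injection_cancel:
  fixes Q R S :: "'a rel"
  assumes "finite Q" and QR: "Field Q \<inter> Field R = {}" and QS: "Field Q \<inter> Field S = {}"
    and g: "pair_injection (direct_sum Q R) (direct_sum Q S) g"
  shows "\<exists>h. pair_injection R S h"
proof -
  define G where "G = map_prod g g"
  define A where "A = Q - Id"
  define B where "B = R - Id"
  define C where "C = S - Id"
  \<comment> \<open>The exit time is taken per vertex, so that \<open>h\<close> is a vertex map. It
    counts from 1 because a point of \<open>R\<close> already starts outside
    \<open>Q\<close>.\<close>
  define k where "k a = (LEAST k. 0 < k \<and> (g ^^ k) a \<notin> Field Q)" for a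
  define h where "h a = (g ^^ k a) a" for a
  have "direct_sum Q R - Id = A \<union> B" "direct_sum Q S - Id = A \<union> C"
    by (auto simp: direct_sum_def A_def B_def C_def)
  then have G: "G \<in> A \<union> B \<rightarrow> A \<union> C" and inj: "inj_on G (A \<union> B)"
    using g by (auto simp: pair_injection_def G_def)
  have Gpow: "(G ^^ n) (a, b) = ((g ^^ n) a, (g ^^ n) b)" for n a b
    by (induction n) (auto simp: G_def)
  have AB: "A \<inter> B = {}" "finite A" using QR \<open>finite Q\<close> by (auto simp: A_def B_def Field_def)
  \<comment> \<open>Up to the exit of the pair from \<open>A\<close> both coordinates are in
    \<open>Field Q\<close>; at the exit the pair is in \<open>C\<close>, so both are in
    \<open>Field S\<close>. The vertex exit times thus agree with that of the pair.\<close>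
  have leave: "\<exists>m>0. (G ^^ m) (a, b) \<in> C \<and> (\<forall>i. 0 < i \<and> i < m \<longrightarrow> (G ^^ i) (a, b) \<in> A)
      \<and> k a = m \<and> k b = m" if ab: "(a, b) \<in> B" for a b
  proof -
    define m where "m = (LEAST k. 0 < k \<and> (G ^^ k) (a, b) \<notin> A)"
    have m: "0 < m \<and> (G ^^ m) (a, b) \<notin> A"
      unfolding m_def using funpow_leaves[OF inj AB(2,1) ab]
      by (rule LeastI_ex[of "\<lambda>k. 0 < k \<and> (G ^^ k) (a, b) \<notin> A"])
    have less: "(G ^^ i) (a, b) \<in> A" if "0 < i" "i < m" for i
      using that not_less_Least[of i "\<lambda>k. 0 < k \<and> (G ^^ k) (a, b) \<notin> A"] unfolding m_def by blast
    obtain n where n: "m = Suc n" using m gr0_implies_Suc by blast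
    have "(G ^^ n) (a, b) \<in> A \<union> B"
    proof (cases "n = 0")
      case False
      then show ?thesis using less[of n] n by simp
    qed (simp add: ab)
    then have "(G ^^ m) (a, b) \<in> A \<union> C" using funcset_mem[OF G] by (simp add: n)
    then have C: "(G ^^ m) (a, b) \<in> C" using m by blast
    have out: "(g ^^ m) a \<notin> Field Q" "(g ^^ m) b \<notin> Field Q"
      using C QS by (auto simp: Gpow C_def Field_def)
    have inside: "(g ^^ i) a \<in> Field Q" "(g ^^ i) b \<in> Field Q" if "0 < i" "i < m" for i
      using less[OF that] by (auto simp: Gpow A_def Field_def)
    have "k a = m" "k b = m"
      unfolding k_def using m out inside by (blast intro: Least_equality leI)+
    then show ?thesis using m C less by blast
  qed
  have hC: "(h a, h b) \<in> C" if "(a, b) \<in> B" for a b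
    using leave[OF that] by (auto simp: h_def Gpow)
  \<comment> \<open>Cancelling the shorter waiting time exhibits \<open>x\<close> as an iterate of
    \<open>y\<close>; a positive exponent would be below \<open>m'\<close> and place
    \<open>x\<close> in \<open>A\<close>.\<close>
  have inj_le: "x = y"
    if B: "x \<in> B" "y \<in> B" and le: "m \<le> m'"
      and m: "\<And>i. 0 < i \<Longrightarrow> i < m \<Longrightarrow> (G ^^ i) x \<in> A"
      and m': "\<And>i. 0 < i \<Longrightarrow> i < m' \<Longrightarrow> (G ^^ i) y \<in> A"
      and "0 < m" and eq: "(G ^^ m) x = (G ^^ m') y" for x y m m'
  proof -
    have x: "x = (G ^^ (m' - m)) y"
      by (rule funpow_cancel[OF inj B, of m]) (simp_all add: le m m' eq)
    have "m' - m = 0"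
    proof (rule ccontr)
      assume "m' - m \<noteq> 0"
      then have "x \<in> A" using m'[of "m' - m"] x \<open>0 < m\<close> by simp
      then show False using B(1) AB(1) by blast
    qed
    then show ?thesis using x by simp
  qed
  have "x = y" if xy: "x \<in> B" "y \<in> B" and eq: "map_prod h h x = map_prod h h y" for x y
  proof -
    obtain a b where x: "x = (a, b)" by (cases x)
    obtain c d where y: "y = (c, d)" by (cases y)
    \<comment> \<open>Both ends of a pair share their exit time, so \<open>h\<close> acts on the
      pair as one power of \<open>G\<close>.\<close>
    have "(G ^^ k a) x = (G ^^ k c) y"
      using eq leave[OF xy(1)[unfolded x]] leave[OF xy(2)[unfolded y]]
      by (simp only: x y Gpow h_def map_prod_simp) metis
    moreover have "0 < k a" "0 < k c"
      and "\<And>i. 0 < i \<Longrightarrow> i < k a \<Longrightarrow> (G ^^ i) x \<in> A"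
      and "\<And>i. 0 < i \<Longrightarrow> i < k c \<Longrightarrow> (G ^^ i) y \<in> A"
      using leave[OF xy(1)[unfolded x]] leave[OF xy(2)[unfolded y]] unfolding x y by blast+
    ultimately show ?thesis
      using inj_le[OF xy, of "k a" "k c"] inj_le[OF xy(2,1), of "k c" "k a"]
      by (cases "k a \<le> k c") simp_all
  qed
  then have "inj_on (map_prod h h) B" by (rule inj_onI)
  moreover have "map_prod h h \<in> B \<rightarrow> C" using hC by (intro funcsetI) (auto simp: map_prod_def split_beta)
  ultimately show ?thesis unfolding pair_injection_def B_def C_def by blast
qed

theorem theorem4:
  fixes \<PP> :: "'p rel set" and Q R S :: "'a rel"
  assumes "representative_system \<PP>"
    and "finite_poset Q" and "finite_poset R" and "finite_poset S"
    and "Field Q \<inter> Field R = {}" and "Field Q \<inter> Field S = {}"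
    and "I_below \<PP> (direct_sum Q R) (direct_sum Q S)"
  shows "I_below \<PP> R S"
proof -
  have po: "Partial_order Q" "Partial_order R" "Partial_order S"
    and fin: "finite (Field Q)" "finite (Field R)" "finite (Field S)"
    using assms(2-4) by (auto simp: finite_poset_def)
  have \<PP>: "Partial_order P" if "P \<in> \<PP>" for P
    using assms(1) that by (auto simp: representative_system_def finite_poset_def)
  note D = I_belowD[OF assms(1) Partial_order_direct_sum[OF po(1,2) assms(5)]
      Partial_order_direct_sum[OF po(1,3) assms(6)] assms(7)]
  obtain f where "f \<in> Field Q \<union> Field R \<rightarrow> Field Q \<union> Field S" "inj_on f (Field Q \<union> Field R)"
    using D(1) by (auto simp: Field_direct_sum)
  \<comment> \<open>\<open>f\<close> may mix the summands and need not restrict to \<open>R\<close>;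
    only the cardinalities are compared, and a new injection is chosen.\<close>
  then have "card (Field Q \<union> Field R) \<le> card (Field Q \<union> Field S)"
    using fin by (intro card_inj_on_le[of f]) auto
  then have "card (Field R) \<le> card (Field S)"
    using fin assms(5,6) by (simp add: card_Un_disjoint)
  then obtain f' where f': "f' \<in> Field R \<rightarrow> Field S" "inj_on f' (Field R)"
    using card_le_inj[OF fin(2,3)] by blast
  have "Q \<subseteq> Field Q \<times> Field Q" by (auto simp: Field_def)
  then have "finite Q" using fin(1) by (meson finite_SigmaI finite_subset)
  then obtain g where "pair_injection R S g"
    using D(2) pair_injection_cancel assms(5,6) by metis
  then show ?thesis by (rule I_below_if_pair_injection[OF po(3) f' _ \<PP>])
qed

end
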